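(* Let $\mathcal{F} \subseteq 2^{[n]}$ be a nonempty union-closed family with $\mathcal{F} \neq \{\emptyset\}$. Then there exists $i \in [n]$ that is contained in at least a $0.01$ fraction of the sets in $\mathcal{F}$, i.e. $|\{A \in \mathcal{F} : i \in A\}| \geq 0.01\,|\mathcal{F}|$.
   Context: Here $[n] = \{1,\dots,n\}$ and $2^{[n]}$ is the set of all subsets of $[n]$. A family $\mathcal{F} \subseteq 2^{[n]}$ is union-closed if for every $A, B \in \mathcal{F}$ the set $A \cup B$ belongs to $\mathcal{F}$. *)

theory Defs
  imports Complex_Main
begin

definition union_closed :: "'a set set \<Rightarrow> bool" where
  "union_closed F \<longleftrightarrow> (\<forall>A\<in>F. \<forall>B\<in>F. A \<union> B \<in> F)"

end

theory Submission
  imports Defs "HOL-Analysis.Convex"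
begin

text \<open>
  This is Gilmer's entropy argument. If \<open>A\<close>, \<open>B\<close> are independent uniform members of \<open>F\<close>, then
  \<open>A \<union> B\<close> lies in \<open>F\<close>, so its entropy is at most \<open>ln |F|\<close>, the entropy of \<open>A\<close>. On the other hand, reveal
  the elements of the ground set one by one. Conditionally on the past, the events \<open>i \<notin> A\<close> and
  \<open>i \<notin> B\<close> are independent with some probabilities \<open>x\<close> and \<open>y\<close>, and \<open>i \<notin> A \<union> B\<close> has probability \<open>x y\<close>.
  The inequality \<open>h (x y) \<ge> 3/5 (x h y + y h x)\<close> for the binary entropy \<open>h\<close> shows, after averaging,
  that the entropy of \<open>A \<union> B\<close> is at least \<open>6/5 \<theta>\<close> times that of \<open>A\<close> when each element is
  avoided with probability at least \<open>\<theta>\<close>. With \<open>\<theta> = 99/100\<close> this forces \<open>ln |F| = 0\<close>.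
\<close>

section \<open>Binary entropy\<close>

definition eta :: "real \<Rightarrow> real" where
  "eta x = - x * ln x"

text \<open>The homogeneous form \<open>s h (a / s)\<close> of the binary entropy, which avoids dividing by \<open>s = 0\<close>.\<close>

definition bin_ent :: "real \<Rightarrow> real \<Rightarrow> real" where
  "bin_ent a s = eta a + eta (s - a) - eta s"

lemma eta_0 [simp]: "eta 0 = 0" and eta_1 [simp]: "eta 1 = 0"
  by (simp_all add: eta_def)

lemma bin_ent_0 [simp]: "bin_ent 0 s = 0" and bin_ent_self [simp]: "bin_ent s s = 0"
  by (simp_all add: bin_ent_def)

lemma eta_mult:
  assumes "x \<ge> 0" "y \<ge> 0"
  shows "eta (x * y) = x * eta y + y * eta x"
  using assms by (cases "x = 0 \<or> y = 0") (auto simp: eta_def ln_mult algebra_simps)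

lemma bin_ent_scale:
  assumes "t \<ge> 0" "0 \<le> a" "a \<le> s"
  shows "bin_ent (t * a) (t * s) = t * bin_ent a s"
proof -
  have "eta (t * s - t * a) = t * eta (s - a) + (s - a) * eta t"
    using assms eta_mult[of t "s - a"] by (simp add: right_diff_distrib)
  then show ?thesis
    using assms by (simp add: bin_ent_def eta_mult algebra_simps)
qed

lemma bin_ent_nonneg:
  assumes "0 \<le> a" "a \<le> s"
  shows "bin_ent a s \<ge> 0"
proof (cases "a = 0 \<or> a = s")
  case False
  with assms have "0 < a" "a < s" by auto
  then have "a * ln a \<le> a * ln s" "(s - a) * ln (s - a) \<le> (s - a) * ln s"
    by auto
  then show ?thesis
    by (simp add: bin_ent_def eta_def algebra_simps)
qed auto

text \<open>The right side is the tangent line at \<open>m\<close> of the concave function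
  \<open>eta\<close>; the bound comes from \<open>ln u \<le> u - 1\<close>.\<close>

lemma eta_le:
  assumes "a \<ge> 0" "m > 0"
  shows "eta a \<le> m - a - a * ln m"
proof (cases "a = 0")
  case False
  with assms have "a > 0" by simp
  with assms have "a * ln (m / a) \<le> a * (m / a - 1)"
    by (intro mult_left_mono ln_le_minus_one) auto
  then show ?thesis
    using \<open>a > 0\<close> \<open>m > 0\<close> by (simp add: eta_def ln_div algebra_simps)
qed (use assms in auto)

text \<open>Gibbs' inequality: coding with a guessed probability \<open>m\<close> costs at least the
  entropy. The bound is linear in \<open>(a, s)\<close> and, for \<open>0 < a < s\<close>, tight at
  \<open>m = a / s\<close>.\<close>

lemma bin_ent_le:
  assumes "0 \<le> a" "a \<le> s" "0 < m" "m < 1"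
  shows "bin_ent a s \<le> - a * ln m - (s - a) * ln (1 - m)"
proof (cases "s = 0")
  case False
  with assms have s: "s > 0" by simp
  have "eta a \<le> m * s - a - a * ln (m * s)"
    and "eta (s - a) \<le> (1 - m) * s - (s - a) - (s - a) * ln ((1 - m) * s)"
    using assms s by (auto intro!: eta_le)
  moreover have "ln (m * s) = ln m + ln s" "ln ((1 - m) * s) = ln (1 - m) + ln s"
    using assms s by (simp_all add: ln_mult)
  ultimately show ?thesis
    by (simp add: bin_ent_def eta_def algebra_simps)
qed (use assms in auto)

text \<open>Conditioning lowers entropy. All summands are bounded by one linear form, chosen to be
  tight at the totals.\<close>

lemma sum_bin_ent_le:
  assumes "finite I" "\<And>i. i \<in> I \<Longrightarrow> 0 \<le> a i" "\<And>i. i \<in> I \<Longrightarrow> a i \<le> s i"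
  shows "(\<Sum>i\<in>I. bin_ent (a i) (s i)) \<le> bin_ent (sum a I) (sum s I)"
proof -
  let ?A = "sum a I" and ?S = "sum s I"
  have A: "0 \<le> ?A" "?A \<le> ?S"
    using assms by (auto intro: sum_nonneg sum_mono)
  \<comment> \<open>\<open>bin_ent_le\<close> needs \<open>0 < m < 1\<close>, so the two degenerate
    cases, in which every summand vanishes, are treated apart.\<close>
  consider "?A = 0" | "?S - ?A = 0" | "0 < ?A" "?A < ?S"
    using A by linarith
  then show ?thesis
  proof cases
    case 1
    then have "\<forall>i\<in>I. a i = 0"
      using assms by (simp add: sum_nonneg_eq_0_iff)
    then show ?thesis
      by simp
  next
    case 2
    then have "(\<Sum>i\<in>I. s i - a i) = 0"
      by (simp add: sum_subtractf)
    then have "\<forall>i\<in>I. s i - a i = 0"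
      using assms by (subst (asm) sum_nonneg_eq_0_iff) auto
    then show ?thesis
      using 2 by simp
  next
    case 3
    define m where "m = ?A / ?S"
    have m: "0 < m" "m < 1"
      using 3 by (auto simp: m_def)
    have "(\<Sum>i\<in>I. bin_ent (a i) (s i)) \<le> (\<Sum>i\<in>I. - a i * ln m - (s i - a i) * ln (1 - m))"
      using assms m by (intro sum_mono bin_ent_le) auto
    also have "\<dots> = - ?A * ln m - (?S - ?A) * ln (1 - m)"
      by (simp add: sum_subtractf sum_negf flip: sum_distrib_right)
    also have "1 - m = (?S - ?A) / ?S"
      using 3 by (simp add: m_def field_simps)
    also have "- ?A * ln m - (?S - ?A) * ln ((?S - ?A) / ?S) = bin_ent ?A ?S"
      using 3 by (simp add: m_def bin_ent_def eta_def ln_div algebra_simps)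
    finally show ?thesis .
  qed
qed

section \<open>The binary entropy of a product\<close>

text \<open>The difference of the two sides vanishes at 0 and has the nonnegative derivative
  \<open>t\<^sup>2 / (1 - t)\<close>.\<close>

lemma minus_ln_one_minus_ge:
  assumes "0 \<le> x" "x < (1 :: real)"
  shows "x + x\<^sup>2 / 2 \<le> - ln (1 - x)"
proof -
  let ?f = "\<lambda>x::real. - ln (1 - x) - x - x\<^sup>2 / 2"
  have "?f 0 \<le> ?f x"
  proof (rule DERIV_nonneg_imp_nondecreasing[OF assms(1)])
    fix t assume t: "0 \<le> t" "t \<le> x"
    have "(?f has_real_derivative t\<^sup>2 / (1 - t)) (at t)"
      using t assms by (auto intro!: derivative_eq_intros simp: field_simps power2_eq_square)
    then show "\<exists>y. (?f has_real_derivative y) (at t) \<and> 0 \<le> y"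
      using t assms by (intro exI[of _ "t\<^sup>2 / (1 - t)"]) auto
  qed
  then show ?thesis
    by simp
qed

text \<open>This is the diagonal case of the product inequality. Bounding \<open>- ln x\<close> by
  \<open>1 - x\<close>, \<open>L\<close> by \<open>x + x\<^sup>2 / 2\<close> and \<open>M\<close> by
  \<open>x\<close> leaves a polynomial inequality; the constant 6/5 is small enough for these crude
  bounds.\<close>

lemma bin_ent_square_ge:
  assumes "0 < x" "x < 1"
  shows "bin_ent (x\<^sup>2) 1 \<ge> 6 / 5 * x * bin_ent x 1"
proof -
  define L where "L = - ln (1 - x)"
  define M where "M = ln (1 + x)"
  have ln_sq: "ln (1 - x\<^sup>2) = M - L"
  proof -
    have "1 - x\<^sup>2 = (1 + x) * (1 - x)"
      by (simp add: power2_eq_square algebra_simps)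
    then show ?thesis
      using assms by (simp add: ln_mult L_def M_def)
  qed
  have "L \<ge> x + x\<^sup>2 / 2"
    using assms minus_ln_one_minus_ge[of x] by (simp add: L_def)
  then have "L * (1 - x / 5) \<ge> (x + x\<^sup>2 / 2) * (1 - x / 5)"
    using assms by (intro mult_right_mono) auto
  moreover have "(1 + x) * M \<le> (1 + x) * x"
    using assms by (intro mult_left_mono) (auto simp: M_def ln_add_one_self_le_self)
  moreover have "4 / 5 * x\<^sup>2 + (x + x\<^sup>2 / 2) * (1 - x / 5) - (1 + x) * x = x\<^sup>2 * (1 - x) / 10"
    by (simp add: power2_eq_square field_simps)
  moreover have "x\<^sup>2 * (1 - x) / 10 \<ge> 0"
    using assms by simp
  ultimately have "0 \<le> (1 - x) * (4 / 5 * x\<^sup>2 + L * (1 - x / 5) - (1 + x) * M)"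
    using assms by (intro mult_nonneg_nonneg) linarith+
  also have "\<dots> = 4 / 5 * x\<^sup>2 * (1 - x) + (1 - x) * (L * (1 - x / 5) - (1 + x) * M)"
    by (simp add: algebra_simps)
  also have "\<dots> \<le> 4 / 5 * x\<^sup>2 * (- ln x) + (1 - x) * (L * (1 - x / 5) - (1 + x) * M)"
    using assms ln_le_minus_one[of x] by (intro add_right_mono mult_left_mono) auto
  also have "\<dots> = bin_ent (x\<^sup>2) 1 - 6 / 5 * x * bin_ent x 1"
  proof -
    have "ln (x\<^sup>2) = 2 * ln x" "ln (1 - x) = - L"
      using assms by (simp_all add: ln_realpow L_def)
    then show ?thesis
      unfolding bin_ent_def eta_def ln_sq by (simp add: power2_eq_square field_simps)
  qed
  finally show ?thesis
    by simp
qed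

text \<open>In the variable \<open>s = - ln x\<close>, fixing a product means fixing a sum, so
  concavity of \<open>h x / x\<close> will compare a pair with its geometric mean. The second
  derivative of the closed form \<open>?g\<close> is controlled by
  \<open>- ln (1 - u) \<le> u / (1 - u)\<close>.\<close>

lemma concave_bin_ent_exp: "concave_on {0<..} (\<lambda>s. bin_ent (exp (- s)) 1 * exp s)"
proof -
  let ?g = "\<lambda>s::real. s - (exp s - 1) * ln (1 - exp (- s))"
  have "concave_on {0<..} ?g"
  proof (rule f''_le0_imp_concave)
    fix s :: real assume "s \<in> {0<..}"
    then have s: "exp (- s) < 1"
      by simp
    have inv: "exp s * exp (- s) = 1"
      by (simp flip: exp_add)
    then have cancel: "(exp s - 1) * (exp (- s) / (1 - exp (- s))) = 1"
      "exp s * (exp (- s) / (1 - exp (- s))) = 1 / (1 - exp (- s))"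
      using s by (simp_all add: field_simps)
    have "(?g has_real_derivative 1 - (exp s * ln (1 - exp (- s))
        + (exp s - 1) * (exp (- s) / (1 - exp (- s))))) (at s)"
      using s by (auto intro!: derivative_eq_intros)
    then show "(?g has_real_derivative - (exp s * ln (1 - exp (- s)))) (at s)"
      by (simp only: cancel) simp
    have "((\<lambda>s. - (exp s * ln (1 - exp (- s)))) has_real_derivative
        - (exp s * ln (1 - exp (- s)) + exp s * (exp (- s) / (1 - exp (- s))))) (at s)"
      using s by (auto intro!: derivative_eq_intros)
    then show "((\<lambda>s. - (exp s * ln (1 - exp (- s)))) has_real_derivative
        - (exp s * ln (1 - exp (- s))) - 1 / (1 - exp (- s))) (at s)"
      by (simp only: cancel) simp
    have "ln (1 / (1 - exp (- s))) \<le> 1 / (1 - exp (- s)) - 1"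
      using s by (intro ln_le_minus_one) auto
    then have "- ln (1 - exp (- s)) \<le> exp (- s) / (1 - exp (- s))"
      using s by (simp add: ln_div field_simps)
    then have "exp s * - ln (1 - exp (- s)) \<le> exp s * (exp (- s) / (1 - exp (- s)))"
      by (intro mult_left_mono) auto
    then show "- (exp s * ln (1 - exp (- s))) - 1 / (1 - exp (- s)) \<le> 0"
      by (simp only: mult_minus_right cancel diff_le_0_iff_le)
  qed simp
  moreover have "?g s = bin_ent (exp (- s)) 1 * exp s" for s
  proof -
    have "bin_ent (exp (- s)) 1 = s * exp (- s) - (1 - exp (- s)) * ln (1 - exp (- s))"
      by (simp add: bin_ent_def eta_def left_diff_distrib)
    then show ?thesis
      by (simp add: exp_minus field_simps)
  qed
  ultimately show ?thesis
    by simp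
qed

text \<open>After division by \<open>x * y\<close> the left side depends on the product only, and
  the right side is a sum of two values of the concave function above.\<close>

lemma bin_ent_mult_1_ge:
  assumes "0 \<le> x" "x \<le> 1" "0 \<le> y" "y \<le> 1"
  shows "bin_ent (x * y) 1 \<ge> 3 / 5 * (x * bin_ent y 1 + y * bin_ent x 1)"
proof -
  consider "x = 0 \<or> y = 0" | "x = 1" | "y = 1" | "0 < x" "x < 1" "0 < y" "y < 1"
    using assms by linarith
  then show ?thesis
  proof cases
    case 4
    define g where "g s = bin_ent (exp (- s)) 1 * exp s" for s :: real
    define s t where "s = - ln x" and "t = - ln y"
    define z where "z = exp (- ((s + t) / 2))"
    have st: "s > 0" "t > 0" and xy: "x = exp (- s)" "y = exp (- t)"
      using 4 by (auto simp: s_def t_def)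
    have z: "0 < z" "z < 1" and z2: "z\<^sup>2 = x * y"
      using st by (auto simp: z_def xy power2_eq_square simp flip: exp_add)
    \<comment> \<open>Concavity reduces the claim to the case \<open>x = y = z\<close>.\<close>
    have "1 / 2 * g s + 1 / 2 * g t \<le> g ((1 / 2) *\<^sub>R s + (1 / 2) *\<^sub>R t)"
      using concave_onD[OF concave_bin_ent_exp, of "1 / 2" s t] st by (simp add: g_def)
    also have "(1 / 2) *\<^sub>R s + (1 / 2) *\<^sub>R t = (s + t) / 2"
      by simp
    also have "g ((s + t) / 2) = bin_ent z 1 / z"
      by (simp add: g_def z_def exp_minus field_simps)
    finally have "3 / 5 * (g s + g t) \<le> 6 / 5 * (bin_ent z 1 / z)"
      by simp
    also have "g s = bin_ent x 1 / x"
      by (simp add: g_def xy exp_minus field_simps)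
    also have "g t = bin_ent y 1 / y"
      by (simp add: g_def xy exp_minus field_simps)
    finally have "(x * y) * (3 / 5 * (bin_ent x 1 / x + bin_ent y 1 / y))
        \<le> (x * y) * (6 / 5 * (bin_ent z 1 / z))"
      using 4 by (intro mult_left_mono) auto
    also have "\<dots> = 6 / 5 * z * bin_ent z 1"
      using z by (simp flip: z2 add: power2_eq_square)
    also have "\<dots> \<le> bin_ent (x * y) 1"
      using bin_ent_square_ge[OF z] z2 by simp
    also have "(x * y) * (3 / 5 * (bin_ent x 1 / x + bin_ent y 1 / y))
        = 3 / 5 * (x * bin_ent y 1 + y * bin_ent x 1)"
      using 4 by (simp add: field_simps)
    finally show ?thesis .
  qed (use assms bin_ent_nonneg[of x 1] bin_ent_nonneg[of y 1] in auto)
qed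

lemma bin_ent_mult_ge:
  assumes "0 \<le> a" "a \<le> s" "0 \<le> b" "b \<le> t"
  shows "bin_ent (a * b) (s * t) \<ge> 3 / 5 * (a * bin_ent b t + b * bin_ent a s)"
proof (cases "s = 0 \<or> t = 0")
  case False
  with assms have st: "s > 0" "t > 0" by auto
  have norm: "bin_ent c u = u * bin_ent (c / u) 1" if "0 \<le> c" "c \<le> u" "u > 0" for c u
    using bin_ent_scale[of u "c / u" 1] that by simp
  have "3 / 5 * (a * bin_ent b t + b * bin_ent a s)
      = s * t * (3 / 5 * (a / s * bin_ent (b / t) 1 + b / t * bin_ent (a / s) 1))"
    using st assms norm[of a s] norm[of b t] by (simp add: field_simps)
  also have "\<dots> \<le> s * t * bin_ent (a / s * (b / t)) 1"
    using st assms by (intro mult_left_mono bin_ent_mult_1_ge) auto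
  also have "\<dots> = bin_ent (a * b) (s * t)"
    using st assms norm[of "a * b" "s * t"] by (simp add: mult_mono)
  finally show ?thesis .
qed (use assms in auto)

section \<open>Weights on the subsets of a finite set\<close>

definition entropy :: "'a set \<Rightarrow> ('a set \<Rightarrow> real) \<Rightarrow> real" where
  "entropy S w = (\<Sum>T\<in>Pow S. eta (w T))"

text \<open>For \<open>T\<close> without \<open>i\<close>, the quotient
  \<open>w T / marginal i w T\<close> is the conditional probability of avoiding \<open>i\<close>
  when the other elements form \<open>T\<close>.\<close>

definition marginal :: "'a \<Rightarrow> ('a set \<Rightarrow> real) \<Rightarrow> 'a set \<Rightarrow> real" where
  "marginal i w T = w T + w (insert i T)"

text \<open>The law of \<open>A \<union> B\<close> for independent \<open>A\<close> and
  \<open>B\<close> with law \<open>w\<close>; the weights need not have total 1.\<close>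

definition union_law :: "'a set \<Rightarrow> ('a set \<Rightarrow> real) \<Rightarrow> 'a set \<Rightarrow> real" where
  "union_law S w T = (\<Sum>A\<in>Pow S. \<Sum>B\<in>Pow S. if A \<union> B = T then w A * w B else 0)"

lemma sum_Pow_insert:
  assumes "finite S" "i \<notin> S"
  shows "sum w (Pow (insert i S)) = sum (marginal i w) (Pow S)"
proof -
  have "sum w (Pow (insert i S)) = sum w (Pow S) + sum w (insert i ` Pow S)"
    unfolding Pow_insert using assms by (intro sum.union_disjoint) auto
  also have "sum w (insert i ` Pow S) = (\<Sum>T\<in>Pow S. w (insert i T))"
    using assms by (intro sum.reindex[unfolded comp_def]) (auto simp: inj_on_def)
  finally show ?thesis
    by (simp add: marginal_def sum.distrib)
qed

text \<open>The chain rule: the last sum is the entropy of the bit \<open>i\<close> conditioned on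
  the trace on \<open>S\<close>.\<close>

lemma entropy_insert:
  assumes "finite S" "i \<notin> S"
  shows "entropy (insert i S) w
    = entropy S (marginal i w) + (\<Sum>T\<in>Pow S. bin_ent (w T) (marginal i w T))"
  using assms
  by (simp add: entropy_def sum_Pow_insert bin_ent_def sum.distrib sum_subtractf marginal_def)

text \<open>A union avoids \<open>i\<close> only if both sets do.\<close>

lemma union_law_insert:
  assumes "finite S" "i \<notin> S" "T \<subseteq> S"
  shows "union_law (insert i S) w T = union_law S w T"
proof -
  have "insert i X \<noteq> T" for X
    using assms by auto
  then show ?thesis
    using assms by (simp add: union_law_def sum_Pow_insert marginal_def)
qed

text \<open>Forgetting \<open>i\<close> commutes with taking unions.\<close>

lemma marginal_union_law:
  assumes "finite S" "i \<notin> S" "T \<subseteq> S"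
  shows "marginal i (union_law (insert i S) w) T = union_law S (marginal i w) T"
proof -
  have iff: "insert i (A \<union> B) = insert i T \<longleftrightarrow> A \<union> B = T" "A \<union> B \<noteq> insert i T"
    if "A \<in> Pow S" "B \<in> Pow S" for A B
  proof -
    have "i \<notin> A \<union> B" "i \<notin> T"
      using that assms by auto
    then show "insert i (A \<union> B) = insert i T \<longleftrightarrow> A \<union> B = T" "A \<union> B \<noteq> insert i T"
      by (simp_all add: insert_ident) blast
  qed
  have neq: "insert i X \<noteq> T" for X
    using assms by auto
  show ?thesis
    unfolding marginal_def[of i "union_law (insert i S) w"] union_law_def
      sum_Pow_insert[OF assms(1,2)] sum.distrib[symmetric]
    unfolding marginal_def sum.distrib[symmetric]
    by (intro sum.cong refl) (simp add: iff neq algebra_simps)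
qed

text \<open>Each pair is counted for exactly one \<open>T\<close>, its union. A general
  \<open>\<phi>\<close> serves both for masses and for entropies of pairs.\<close>

lemma sum_union_law_gen:
  assumes "finite S"
  shows "(\<Sum>T\<in>Pow S. \<Sum>A\<in>Pow S. \<Sum>B\<in>Pow S. if A \<union> B = T then \<phi> A B else 0)
    = (\<Sum>A\<in>Pow S. \<Sum>B\<in>Pow S. \<phi> A B :: real)"
proof -
  have "(\<Sum>T\<in>Pow S. \<Sum>A\<in>Pow S. \<Sum>B\<in>Pow S. if A \<union> B = T then \<phi> A B else 0)
    = (\<Sum>A\<in>Pow S. \<Sum>B\<in>Pow S. \<Sum>T\<in>Pow S. if A \<union> B = T then \<phi> A B else 0)"
    by (subst sum.swap, rule sum.cong[OF refl], rule sum.swap)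
  also have "\<dots> = (\<Sum>A\<in>Pow S. \<Sum>B\<in>Pow S. \<phi> A B)"
    using assms by (intro sum.cong refl) (auto simp: sum.delta)
  finally show ?thesis .
qed

lemma sum_union_law:
  assumes "finite S"
  shows "sum (union_law S w) (Pow S) = (sum w (Pow S))\<^sup>2"
  using sum_union_law_gen[OF assms, of "\<lambda>A B. w A * w B"]
  by (simp add: union_law_def power2_eq_square sum_product)

text \<open>
  The entropy of the next bit of the union is conditioned on \<open>T = A \<union> B\<close> only; by superadditivity of
  \<open>bin_ent\<close> it decreases on conditioning on the pair \<open>(A, B)\<close>, which makes the two bits independent.
\<close>

lemma sum_bin_ent_union_law_ge:
  assumes "finite S" and w: "\<And>A. A \<subseteq> S \<Longrightarrow> 0 \<le> w A" "\<And>A. A \<subseteq> S \<Longrightarrow> w A \<le> v A"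
  shows "(\<Sum>T\<in>Pow S. bin_ent (union_law S w T) (union_law S v T))
    \<ge> 6 / 5 * sum w (Pow S) * (\<Sum>A\<in>Pow S. bin_ent (w A) (v A))"
proof -
  have v: "0 \<le> v A" if "A \<subseteq> S" for A
    using w that by (meson order_trans)
  have le: "w A * w B \<le> v A * v B" if "A \<subseteq> S" "B \<subseteq> S" for A B
    using w v that by (intro mult_mono) auto
  have fin: "finite (Pow S)"
    using assms by simp
  \<comment> \<open>Exchanging \<open>A\<close> and \<open>B\<close> shows that both terms have the
    same double sum, which turns 3/5 into 6/5.\<close>
  have "6 / 5 * sum w (Pow S) * (\<Sum>A\<in>Pow S. bin_ent (w A) (v A))
      = (\<Sum>A\<in>Pow S. \<Sum>B\<in>Pow S. 3 / 5 * (w A * bin_ent (w B) (v B) + w B * bin_ent (w A) (v A)))"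
  proof -
    have "(\<Sum>A\<in>Pow S. \<Sum>B\<in>Pow S. w B * bin_ent (w A) (v A))
        = (\<Sum>A\<in>Pow S. \<Sum>B\<in>Pow S. w A * bin_ent (w B) (v B))"
      by (rule sum.swap)
    moreover have "(\<Sum>A\<in>Pow S. \<Sum>B\<in>Pow S. w A * bin_ent (w B) (v B))
        = sum w (Pow S) * (\<Sum>A\<in>Pow S. bin_ent (w A) (v A))"
      by (simp only: sum_product)
    ultimately show ?thesis
      by (simp only: sum.distrib flip: sum_distrib_left) simp
  qed
  also have "\<dots> \<le> (\<Sum>A\<in>Pow S. \<Sum>B\<in>Pow S. bin_ent (w A * w B) (v A * v B))"
    using w by (intro sum_mono bin_ent_mult_ge) auto
  also have "\<dots> = (\<Sum>T\<in>Pow S. \<Sum>A\<in>Pow S. \<Sum>B\<in>Pow S.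
      if A \<union> B = T then bin_ent (w A * w B) (v A * v B) else 0)"
    by (rule sum_union_law_gen[OF assms(1), symmetric])
  \<comment> \<open>Since \<open>bin_ent 0 0 = 0\<close>, the condition can move into the arguments;
    superadditivity then applies to the sum over \<open>B\<close> and to the sum over
    \<open>A\<close>.\<close>
  also have "\<dots> = (\<Sum>T\<in>Pow S. \<Sum>A\<in>Pow S. \<Sum>B\<in>Pow S.
      bin_ent (if A \<union> B = T then w A * w B else 0) (if A \<union> B = T then v A * v B else 0))"
    by (intro sum.cong refl) simp
  also have "\<dots> \<le> (\<Sum>T\<in>Pow S. \<Sum>A\<in>Pow S. bin_ent
      (\<Sum>B\<in>Pow S. if A \<union> B = T then w A * w B else 0)
      (\<Sum>B\<in>Pow S. if A \<union> B = T then v A * v B else 0))"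
    using w le by (intro sum_mono sum_bin_ent_le fin) auto
  also have "\<dots> \<le> (\<Sum>T\<in>Pow S. bin_ent (union_law S w T) (union_law S v T))"
    unfolding union_law_def
    using w le by (intro sum_mono sum_bin_ent_le fin sum_nonneg) auto
  finally show ?thesis .
qed

text \<open>The chain rule splits both entropies: the induction hypothesis for the marginal handles
  the trace on \<open>S\<close>, and the preceding lemma handles the bit \<open>i\<close>.\<close>

theorem entropy_union_law_ge:
  assumes "finite S" and "\<And>A. A \<subseteq> S \<Longrightarrow> 0 \<le> w A" and "sum w (Pow S) = 1"
    and "\<And>i. i \<in> S \<Longrightarrow> \<theta> \<le> sum w (Pow (S - {i}))"
  shows "6 / 5 * \<theta> * entropy S w \<le> entropy S (union_law S w)"
  using assms
proof (induction S arbitrary: w rule: finite_induct)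
  case empty
  then show ?case
    by (simp add: entropy_def union_law_def)
next
  case (insert i S)
  let ?v = "marginal i w"
  have nonneg: "0 \<le> w A" "0 \<le> w (insert i A)" if "A \<subseteq> S" for A
    using insert.prems(1) that by blast+
  have IH: "6 / 5 * \<theta> * entropy S ?v \<le> entropy S (union_law S ?v)"
  proof (rule insert.IH)
    show "0 \<le> ?v A" if "A \<subseteq> S" for A
      using nonneg[OF that] by (simp add: marginal_def)
    show "sum ?v (Pow S) = 1"
      using insert.prems(2) insert.hyps by (simp add: sum_Pow_insert)
    show "\<theta> \<le> sum ?v (Pow (S - {j}))" if "j \<in> S" for j
    proof -
      have "insert i S - {j} = insert i (S - {j})"
        using that insert.hyps by auto
      then show ?thesis
        using insert.prems(3)[of j] that insert.hyps by (simp add: sum_Pow_insert)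
    qed
  qed
  let ?D = "\<Sum>A\<in>Pow S. bin_ent (w A) (?v A)"
  \<comment> \<open>The sum is the probability of avoiding \<open>i\<close>.\<close>
  have "\<theta> \<le> sum w (Pow S)"
    using insert.prems(3)[of i] insert.hyps by simp
  moreover have "?D \<ge> 0"
    using nonneg by (intro sum_nonneg bin_ent_nonneg) (auto simp: marginal_def)
  ultimately have "6 / 5 * \<theta> * ?D \<le> 6 / 5 * sum w (Pow S) * ?D"
    by (intro mult_right_mono) auto
  also have "\<dots> \<le> (\<Sum>T\<in>Pow S. bin_ent (union_law S w T) (union_law S ?v T))"
    using nonneg insert.hyps by (intro sum_bin_ent_union_law_ge) (auto simp: marginal_def)
  finally have step: "6 / 5 * \<theta> * ?D \<le> \<dots>" .
  have "6 / 5 * \<theta> * entropy (insert i S) w = 6 / 5 * \<theta> * entropy S ?v + 6 / 5 * \<theta> * ?D"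
    using insert.hyps by (simp add: entropy_insert algebra_simps)
  also have "\<dots> \<le> entropy S (union_law S ?v)
      + (\<Sum>T\<in>Pow S. bin_ent (union_law S w T) (union_law S ?v T))"
    using IH step by linarith
  also have "\<dots> = entropy (insert i S) (union_law (insert i S) w)"
    unfolding entropy_insert[OF insert.hyps] unfolding entropy_def
    using insert.hyps
    by (intro arg_cong2[where f = "(+)"] sum.cong refl)
       (simp_all add: marginal_union_law union_law_insert)
  finally show ?case .
qed

text \<open>The uniform law maximizes entropy on a given support: the tangents of \<open>eta\<close>
  at \<open>1 / card F\<close> add up to \<open>ln (card F)\<close>.\<close>

lemma entropy_le_ln_card:
  assumes "finite S" "F \<subseteq> Pow S" "F \<noteq> {}"
    and w: "\<And>A. A \<in> F \<Longrightarrow> 0 \<le> w A" "\<And>A. A \<in> Pow S - F \<Longrightarrow> w A = 0" "sum w (Pow S) = 1"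
  shows "entropy S w \<le> ln (card F)"
proof -
  have fin: "finite (Pow S)" "finite F"
    using assms by (auto intro: finite_subset[of F "Pow S"])
  then have N: "real (card F) > 0"
    using assms by (simp add: card_gt_0_iff)
  have "entropy S w = (\<Sum>T\<in>F. eta (w T))"
    unfolding entropy_def using assms fin by (intro sum.mono_neutral_right) auto
  also have "\<dots> \<le> (\<Sum>T\<in>F. 1 / card F - w T - w T * ln (1 / card F))"
    using N w by (intro sum_mono eta_le) auto
  also have "\<dots> = 1 - sum w F + sum w F * ln (card F)"
    using N by (simp add: sum_subtractf sum.distrib ln_div flip: sum_distrib_right)
  also have "sum w F = sum w (Pow S)"
    using assms fin by (intro sum.mono_neutral_left) auto
  finally show ?thesis
    using w by simp
qed

theorem theorem2:
  fixes n :: nat and F :: "nat set set"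
  assumes "F \<subseteq> Pow {1..n}"
    and "union_closed F"
    and "F \<noteq> {}"
    and "F \<noteq> {{}}"
  shows "\<exists>i\<in>{1..n}. real (card {A \<in> F. i \<in> A}) \<ge> 0.01 * real (card F)"
proof (rule ccontr)
  assume "\<not> ?thesis"
  then have rare: "real (card {A \<in> F. i \<in> A}) < 0.01 * real (card F)" if "i \<in> {1..n}" for i
    using that by force
  define S where "S = {1..n}"
  define w where "w A = (if A \<in> F then 1 / real (card F) else 0)" for A
  have F: "finite S" "F \<subseteq> Pow S"
    using assms by (auto simp: S_def)
  then have fin: "finite F" "finite (Pow S)"
    using finite_subset by auto
  with assms have N: "real (card F) > 0"
    by (simp add: card_gt_0_iff)
  have sum_w: "sum w X = card (X \<inter> F) / card F" if "finite X" for X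
    using that by (simp add: w_def sum.If_cases Int_def)
  have w1: "sum w (Pow S) = 1"
    using F fin N assms(3) by (simp add: sum_w Int_absorb1)
  have ent: "entropy S w = ln (card F)"
  proof -
    have "entropy S w = (\<Sum>T\<in>F. eta (w T))"
      unfolding entropy_def using F fin by (intro sum.mono_neutral_right) (auto simp: w_def)
    then show ?thesis
      using N by (simp add: w_def eta_def ln_div)
  qed
  have avoid: "99 / 100 \<le> sum w (Pow (S - {i}))" if "i \<in> S" for i
  proof -
    have "F = {A \<in> F. i \<in> A} \<union> (Pow (S - {i}) \<inter> F)"
      using F by auto
    then have "card F = card {A \<in> F. i \<in> A} + card (Pow (S - {i}) \<inter> F)"
      using fin by (subst card_Un_disjoint[symmetric]) auto
    then show ?thesis
      using rare[of i] that F N by (simp add: sum_w S_def field_simps)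
  qed
  have "6 / 5 * (99 / 100) * ln (card F) \<le> entropy S (union_law S w)"
    using entropy_union_law_ge[OF F(1) _ w1 avoid] ent by (simp add: w_def)
  also have "\<dots> \<le> ln (card F)"
  proof (rule entropy_le_ln_card[OF F assms(3)])
    show "0 \<le> union_law S w A" for A
      by (auto simp: union_law_def w_def intro!: sum_nonneg)
    \<comment> \<open>If a union lies outside \<open>F\<close>, one of the two sets does too, and
      its weight is 0.\<close>
    show "union_law S w A = 0" if "A \<in> Pow S - F" for A
      unfolding union_law_def
      using that assms(2) by (intro sum.neutral ballI) (auto simp: w_def union_closed_def)
    show "sum (union_law S w) (Pow S) = 1"
      using w1 F by (simp add: sum_union_law)
  qed
  \<comment> \<open>The factor \<open>6 / 5 * (99 / 100)\<close> exceeds 1, so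
    \<open>ln (card F)\<close> cannot be positive.\<close>
  finally have "ln (real (card F)) \<le> 0"
    by simp
  then have "card F = 1"
    using N by simp
  \<comment> \<open>Any element of the single nonempty member lies in all of \<open>F\<close>,
    contradicting \<open>rare\<close>.\<close>
  then obtain A where A: "F = {A}"
    by (auto simp: card_1_singleton_iff)
  then have "A \<noteq> {}" "A \<subseteq> {1..n}"
    using assms by simp_all
  then obtain i where "i \<in> A" "i \<in> {1..n}"
    by blast
  moreover from this have "{B \<in> F. i \<in> B} = F"
    using A by auto
  ultimately show False
    using rare[of i] N by simp
qed

end
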